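(* Let $A,B,H,K$ be any logically independent events. The probability assessment $\mathcal{P}=(x,y,z)$ on the family of conditional events $\mathcal{F}=\{A|H,\ B|K,\ (B|K)|_{F}(A|H)\}$ is coherent for every $(x,y,z)\in[0,1]^3$.
   Context: Events are two-valued entities (true/false), identified with their indicators (values $1/0$). $\emptyset$ is the impossible event; $AB$ denotes $A\wedge B$; $\overline{A}$ is the negation of $A$. Four events are logically independent if all $16$ conjunctions obtained by taking each event or its negation are different from $\emptyset$. For events $E,H$ with $H\neq\emptyset$, the conditional event $E|H$ is true if $EH$ is true, false if $\overline{E}H$ is true, void if $\overline{H}$ is true. Coherence: a real vector $\mathcal{P}=(p_1,\dots,p_n)$, with $p_j=P(E_j|H_j)$, on $\mathcal{F}=\{E_1|H_1,\dots,E_n|H_n\}$ is coherent iff for every nonempty $J\subseteq\{1,\dots,n\}$ and all real numbers $s_j$ ($j\in J$), the random gain $G=\sum_{j\in J}s_jH_j(E_j-p_j)$, restricted to the cases where $\bigvee_{j\in J}H_j$ is true, satisfies $\min G\le 0\le\max G$. Farrell iterated conditional: $(B|K)|_{F}(A|H)=AHBK|(AHBK\vee AH\overline{B}K\vee\overline{H}\,\overline{B}K)$ (a conditional event). *)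

theory Defs
  imports Complex_Main "HOL-Library.Indicator_Function"
begin

text \<open>
  Events are subsets of a set of possible outcomes, given by a type; conjunction, disjunction and
  negation are intersection, union and complement, and the impossible event is the empty set.
\<close>

type_synonym 'w event = "'w set"

definition literal :: "'w event \<Rightarrow> bool \<Rightarrow> 'w event" where
  "literal E b = (if b then E else - E)"

definition logically_independent4 ::
    "'w event \<Rightarrow> 'w event \<Rightarrow> 'w event \<Rightarrow> 'w event \<Rightarrow> bool" where
  "logically_independent4 A B H K \<longleftrightarrow>
     (\<forall>a b h k. literal A a \<inter> literal B b \<inter> literal H h \<inter> literal K k \<noteq> {})"

text \<open>
  The type itself does not exclude an impossible conditioning event; possibility of the
  conditioning events is required in the definition of coherence.
\<close>

datatype 'w cond_event =
  Given (conditioned: "'w event") (conditioning: "'w event")  (infix \<open>given\<close> 55)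

fun farrell :: "'w cond_event \<Rightarrow> 'w cond_event \<Rightarrow> 'w cond_event"  (infix \<open>given\<^sub>F\<close> 54) where
  "(B given K) given\<^sub>F (A given H) =
     (A \<inter> H \<inter> B \<inter> K) given (A \<inter> H \<inter> B \<inter> K \<union> A \<inter> H \<inter> - B \<inter> K \<union> - H \<inter> - B \<inter> K)"

definition gain ::
    "'w cond_event list \<Rightarrow> real list \<Rightarrow> nat set \<Rightarrow> (nat \<Rightarrow> real) \<Rightarrow> 'w \<Rightarrow> real" where
  "gain F P J s w =
     (\<Sum>j\<in>J. s j * indicator (conditioning (F ! j)) w
               * (indicator (conditioned (F ! j)) w - P ! j))"

definition restricted_gains ::
    "'w cond_event list \<Rightarrow> real list \<Rightarrow> nat set \<Rightarrow> (nat \<Rightarrow> real) \<Rightarrow> real set" where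
  "restricted_gains F P J s = gain F P J s ` (\<Union>j\<in>J. conditioning (F ! j))"

text \<open>
  The gain depends on an outcome only through finitely many indicators, so the set of its
  restricted values is finite even for an infinite outcome type. As the conditioning events are
  possible, it is also nonempty, so its minimum and maximum are meaningful.
\<close>

definition coherent :: "'w cond_event list \<Rightarrow> real list \<Rightarrow> bool" where
  "coherent F P \<longleftrightarrow>
     length P = length F \<and>
     (\<forall>C\<in>set F. conditioning C \<noteq> {}) \<and>
     (\<forall>J. J \<noteq> {} \<and> J \<subseteq> {..<length F} \<longrightarrow>
        (\<forall>s. Min (restricted_gains F P J s) \<le> 0 \<and> 0 \<le> Max (restricted_gains F P J s)))"

end

theory Submission
  imports Defs
begin

text \<open>
  Any nonempty set of bets among the three contains one that can be isolated: there are a winning and a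
  losing outcome for it at which all other bets of the set are called off. At these two outcomes
  the gain is \<open>s\<^sub>j (1 - p\<^sub>j)\<close> and \<open>- s\<^sub>j p\<^sub>j\<close>, which have opposite signs (or vanish) because
  \<open>p\<^sub>j \<in> [0, 1]\<close>; so no choice of stakes gives a uniformly positive or uniformly negative gain
  (lemma \<open>gain_signs_if_isolated\<close>).

  \<^item> If the bet on \<open>A given H\<close> is in the set, it is isolated by making \<open>H\<close> true and \<open>K\<close> false:
    the conditioning events of the other two bets both imply \<open>K\<close>.
  \<^item> Otherwise, if the bet on \<open>B given K\<close> is in the set, it is isolated by making \<open>K\<close> and \<open>H\<close> true
    and \<open>A\<close> false: Farrell's conditioning event implies \<open>A\<close> or the negation of \<open>H\<close>.
  \<^item> Otherwise the iterated conditional is the only bet. It is won when \<open>A\<close>, \<open>H\<close>, \<open>B\<close>, \<open>K\<close> are all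
    true, and lost when \<open>B\<close> is changed to false.

  Logical independence guarantees that all these outcomes exist.
\<close>

text \<open>
  The gain is determined by which of the finitely many events in \<open>F\<close> that are indexed by \<open>J\<close>
  occur (the pattern of the outcome), so the minimum and the maximum
  in the definition of coherence are attained bounds, also when there are infinitely many outcomes.
\<close>

lemma finite_range_gain:
  fixes F :: "'w cond_event list"
  assumes "finite J"
  shows "finite (range (gain F P J s))"
proof -
  define pattern :: "'w \<Rightarrow> nat set \<times> nat set" where
    "pattern = (\<lambda>w. ({j \<in> J. w \<in> conditioning (F ! j)}, {j \<in> J. w \<in> conditioned (F ! j)}))"
  define value_at where
    "value_at = (\<lambda>(C, E). \<Sum>j\<in>J. s j * indicator C j * (indicator E j - P ! j))"
  have "gain F P J s w = value_at (pattern w)" for w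
    unfolding gain_def value_at_def pattern_def
    by (auto intro!: sum.cong simp: indicator_def)
  then have "range (gain F P J s) \<subseteq> value_at ` (Pow J \<times> Pow J)"
    by (auto simp: pattern_def)
  then show ?thesis
    using assms by (meson finite_Pow_iff finite_SigmaI finite_imageI finite_subset)
qed

lemma gain_isolated:
  assumes "finite J" "j \<in> J" "w \<in> conditioning (F ! j)"
    and "\<And>i. i \<in> J \<Longrightarrow> i \<noteq> j \<Longrightarrow> w \<notin> conditioning (F ! i)"
  shows "gain F P J s w = s j * (indicator (conditioned (F ! j)) w - P ! j)"
proof -
  have "(\<Sum>i\<in>J - {j}. s i * indicator (conditioning (F ! i)) w
           * (indicator (conditioned (F ! i)) w - P ! i)) = 0"
    using assms(4) by (intro sum.neutral) auto
  then show ?thesis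
    using assms(1-3) by (simp add: gain_def sum.remove)
qed

text \<open>
  If the stake on the isolated bet is nonnegative, losing gives a gain \<open>\<le> 0\<close> and winning a
  gain \<open>\<ge> 0\<close>; a negative stake exchanges the two.
\<close>

lemma gain_signs_if_isolated:
  assumes "finite J" "j \<in> J" "P ! j \<in> {0..1}"
    and u: "u \<in> conditioning (F ! j)" "u \<in> conditioned (F ! j)"
    and v: "v \<in> conditioning (F ! j)" "v \<notin> conditioned (F ! j)"
    and off: "\<And>i. i \<in> J \<Longrightarrow> i \<noteq> j \<Longrightarrow> u \<notin> conditioning (F ! i) \<and> v \<notin> conditioning (F ! i)"
  shows "Min (restricted_gains F P J s) \<le> 0 \<and> 0 \<le> Max (restricted_gains F P J s)"
proof -
  let ?R = "restricted_gains F P J s"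
  have fin: "finite ?R"
    unfolding restricted_gains_def
    by (rule finite_subset[OF _ finite_range_gain[OF assms(1)]]) auto
  have "gain F P J s u = s j * (1 - P ! j)"
    using gain_isolated[OF assms(1,2) u(1), of P s] u(2) off by simp
  moreover have "gain F P J s u \<in> ?R"
    unfolding restricted_gains_def using assms(2) u(1) by blast
  ultimately have won: "s j * (1 - P ! j) \<in> ?R"
    by simp
  have "gain F P J s v = s j * (0 - P ! j)"
    using gain_isolated[OF assms(1,2) v(1), of P s] v(2) off by simp
  moreover have "gain F P J s v \<in> ?R"
    unfolding restricted_gains_def using assms(2) v(1) by blast
  ultimately have lost: "s j * (0 - P ! j) \<in> ?R"
    by simp
  note bounds = Min_le[OF fin won] Min_le[OF fin lost] Max_ge[OF fin won] Max_ge[OF fin lost]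
  show ?thesis
  proof (cases "0 \<le> s j")
    case True
    then have "s j * (0 - P ! j) \<le> 0" "0 \<le> s j * (1 - P ! j)"
      using assms(3) by (auto intro!: mult_nonneg_nonpos mult_nonneg_nonneg)
    then show ?thesis
      using bounds by linarith
  next
    case False
    then have "0 \<le> s j * (0 - P ! j)" "s j * (1 - P ! j) \<le> 0"
      using assms(3) by (auto intro!: mult_nonpos_nonpos mult_nonpos_nonneg)
    then show ?thesis
      using bounds by linarith
  qed
qed

lemma logically_independent4_outcome:
  assumes "logically_independent4 A B H K"
  obtains w where "w \<in> A \<longleftrightarrow> a" "w \<in> B \<longleftrightarrow> b" "w \<in> H \<longleftrightarrow> h" "w \<in> K \<longleftrightarrow> k"
proof -
  obtain w where "w \<in> literal A a \<inter> literal B b \<inter> literal H h \<inter> literal K k"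
    using assms unfolding logically_independent4_def by blast
  then show ?thesis
    by (intro that[of w]) (auto simp: literal_def split: if_splits)
qed

theorem theorem9:
  fixes A B H K :: "'w event" and x y z :: real
  assumes "logically_independent4 A B H K"
    and "x \<in> {0..1}" and "y \<in> {0..1}" and "z \<in> {0..1}"
  shows "coherent [A given H, B given K, (B given K) given\<^sub>F (A given H)] [x, y, z]"
proof -
  let ?F = "[A given H, B given K, (B given K) given\<^sub>F (A given H)]"
  let ?P = "[x, y, z]"
  note outcome = logically_independent4_outcome[OF assms(1)]
  obtain w11 where w11: "w11 \<in> A" "w11 \<in> B" "w11 \<in> H" "w11 \<in> K"
    using outcome[of True True True True] by blast
  obtain w10 where w10: "w10 \<in> A" "w10 \<notin> B" "w10 \<in> H" "w10 \<in> K"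
    using outcome[of True False True True] by blast
  obtain w01 where w01: "w01 \<notin> A" "w01 \<in> B" "w01 \<in> H" "w01 \<in> K"
    using outcome[of False True True True] by blast
  obtain w00 where w00: "w00 \<notin> A" "w00 \<notin> B" "w00 \<in> H" "w00 \<in> K"
    using outcome[of False False True True] by blast
  obtain v1 where v1: "v1 \<in> A" "v1 \<in> H" "v1 \<notin> K"
    using outcome[of True True True False] by blast
  obtain v0 where v0: "v0 \<notin> A" "v0 \<in> H" "v0 \<notin> K"
    using outcome[of False True True False] by blast
  have possible: "\<forall>C\<in>set ?F. conditioning C \<noteq> {}"
    using w11 by auto
  have "Min (restricted_gains ?F ?P J s) \<le> 0 \<and> 0 \<le> Max (restricted_gains ?F ?P J s)"
    if J: "J \<noteq> {}" "J \<subseteq> {..<length ?F}" for J s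
  proof -
    have fin: "finite J"
      using J(2) finite_subset by blast
    have cases3: "i = 0 \<or> i = 1 \<or> i = 2" if "i \<in> J" for i
      using that J(2) by auto
    consider "0 \<in> J" | "0 \<notin> J" "1 \<in> J" | "0 \<notin> J" "1 \<notin> J" "2 \<in> J"
      using J(1) cases3 by blast
    then show ?thesis
    proof cases
      case 1
      have others: "i = 1 \<or> i = 2" if "i \<in> J" "i \<noteq> 0" for i
        using cases3 that by blast
      show ?thesis
        by (rule gain_signs_if_isolated[OF fin 1, where u = v1 and v = v0])
          (use assms(2) v1 v0 in \<open>auto dest!: others simp flip: One_nat_def\<close>)
    next
      case 2
      have others: "i = 2" if "i \<in> J" "i \<noteq> 1" for i
        using cases3 that 2(1) by blast
      show ?thesis
        by (rule gain_signs_if_isolated[OF fin 2(2), where u = w01 and v = w00])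
          (use assms(3) w01 w00 in \<open>auto dest!: others simp flip: One_nat_def\<close>)
    next
      case 3
      have others: False if "i \<in> J" "i \<noteq> 2" for i
        using cases3 that 3(1,2) by blast
      show ?thesis
        by (rule gain_signs_if_isolated[OF fin 3(3), where u = w11 and v = w10])
          (use assms(4) w11 w10 in \<open>auto dest!: others simp flip: One_nat_def\<close>)
    qed
  qed
  then show ?thesis
    using possible unfolding coherent_def by simp
qed

end
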